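(* Let $(X,\|\cdot\|)$ be a separable real transitive Banach space. Then $X$ is strictly convex and $\|\cdot\|$ is Gâteaux differentiable.
   Context: A Banach space $(X,\|\cdot\|)$ is transitive if its group $\mathrm{Isom}(X,\|\cdot\|)$ of surjective linear isometries acts transitively on the unit sphere $S_X=\{x\in X : \|x\|=1\}$. The norm is Gâteaux differentiable if it is Gâteaux differentiable at every point of $S_X$; equivalently, for every $x\in S_X$ there is a unique support functional $\phi_x\in S_{X^*}$, i.e. a unique norm-one functional with $\phi_x(x)=1$. *)

theory Defs
  imports "HOL-Analysis.Analysis"
begin

text \<open>
  A real normed space is modelled by a type of class \<^class>\<open>real_normed_vector\<close> (a Banach space by
  one of class \<^class>\<open>banach\<close>); properties of the whole space take a type argument.
\<close>

definition linear_isometries :: "('a::real_normed_vector \<Rightarrow> 'a) set" where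
  "linear_isometries = {T. linear T \<and> surj T \<and> (\<forall>x. norm (T x) = norm x)}"

definition transitive_norm :: "'a::real_normed_vector itself \<Rightarrow> bool" where
  "transitive_norm (_ :: 'a itself) \<longleftrightarrow>
     (\<forall>x \<in> sphere (0::'a) 1. \<forall>y \<in> sphere 0 1. \<exists>T \<in> linear_isometries. T x = y)"

definition strictly_convex_norm :: "'a::real_normed_vector itself \<Rightarrow> bool" where
  "strictly_convex_norm (_ :: 'a itself) \<longleftrightarrow>
     (\<forall>x \<in> sphere (0::'a) 1. \<forall>y \<in> sphere 0 1. x \<noteq> y \<longrightarrow> norm ((1/2) *\<^sub>R (x + y)) < 1)"

definition gateaux_differentiable_at ::
  "('a::real_normed_vector \<Rightarrow> 'b::real_normed_vector) \<Rightarrow> 'a \<Rightarrow> bool" where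
  "gateaux_differentiable_at f x \<longleftrightarrow>
     (\<exists>D. bounded_linear D \<and>
        (\<forall>v. ((\<lambda>t::real. (f (x + t *\<^sub>R v) - f x) /\<^sub>R t) \<longlongrightarrow> D v) (at 0)))"

definition gateaux_differentiable_norm :: "'a::real_normed_vector itself \<Rightarrow> bool" where
  "gateaux_differentiable_norm (_ :: 'a itself) \<longleftrightarrow>
     (\<forall>x \<in> sphere (0::'a) 1. gateaux_differentiable_at norm x)"

end

theory Submission
  imports Defs
begin

text \<open>
  The idea for both properties is that transitivity makes all points of the sphere alike, so that
  a property found at one point holds at every point.

  Smoothness is Mazur's theorem. Points at which the second difference
  \<open>norm (x + t v) + norm (x - t v) - 2 norm x\<close> drops below \<open>e t\<close> for some \<open>t > 0\<close> form an open
  dense set for each direction \<open>v\<close> and each \<open>e > 0\<close>. Baire's theorem, with \<open>v\<close> in a countable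
  dense set, gives a point where the norm is Gateaux differentiable
  (\<open>Mazur_smooth_points_dense\<close>), and the isometries carry it everywhere.

  For strict convexity, suppose that \<open>x \<noteq> y\<close> and their midpoint lie on the sphere. The derivative
  \<open>\<phi>\<close> of the norm at the midpoint cuts out the face \<open>F\<close> of the unit ball where \<open>\<phi> = 1\<close>, which
  contains \<open>x\<close> and \<open>y\<close>. An isometry taking one point of \<open>F\<close> to another fixes \<open>\<phi>\<close>, because
  a smooth point has only one support functional, and so it maps \<open>F\<close> onto itself. Hence all
  points of the closed bounded convex set \<open>F\<close> look alike from inside \<open>F\<close>
  (\<open>transitive_face_quasi_interior\<close>). But they do not. If \<open>(a\<^sub>i)\<close> is dense in \<open>F\<close>, then from the
  point \<open>z = \<Sum>i. 2\<^sup>-\<^sup>i\<^sup>-\<^sup>1 a\<^sub>i\<close> one can move a little further away from any \<open>a\<^sub>i\<close> without leaving \<open>F\<close>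
  (\<open>quasi_interior_nonempty\<close>). On the other hand, as in the Bishop-Phelps theorem, some point of
  \<open>F\<close> almost maximizes a continuous functional that separates \<open>x\<close> from \<open>y\<close>, in the sense of
  Ekeland's variational principle, and such a point cannot have this property
  (\<open>not_all_quasi_interior\<close>).

  Both \<open>\<phi>\<close> and the separating functional are derivatives of the norm, so smoothness supplies the
  functionals on which the second half relies.
\<close>

section \<open>Smooth points of the norm\<close>

text \<open>
  Gateaux differentiability of the norm at \<open>x\<close>, written without the derivative: the second
  difference of the norm is \<open>o(t)\<close>. By convexity its quotient by \<open>t\<close> is monotone, so one small
  value of the quotient already bounds all those for smaller \<open>t\<close>. The existential
  form is the one that describes open sets, as Baire's theorem requires.
\<close>

definition smooth_at :: "'a::real_normed_vector \<Rightarrow> bool" where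
  "smooth_at x \<longleftrightarrow> (\<forall>v. \<forall>e>0. \<exists>t>0.
     norm (x + t *\<^sub>R v) + norm (x - t *\<^sub>R v) < 2 * norm x + e * t)"

text \<open>
  \<open>l\<close> is a subgradient at \<open>0\<close> of the convex function \<open>u \<mapsto> norm (x + u v)\<close> of one real variable.
\<close>

definition norm_slope :: "'a::real_normed_vector \<Rightarrow> 'a \<Rightarrow> real \<Rightarrow> bool" where
  "norm_slope x v l \<longleftrightarrow> (\<forall>u. norm x + u * l \<le> norm (x + u *\<^sub>R v))"

definition supports_at :: "('a::real_normed_vector \<Rightarrow> real) \<Rightarrow> 'a \<Rightarrow> bool" where
  "supports_at \<phi> x \<longleftrightarrow> linear \<phi> \<and> (\<forall>v. \<phi> v \<le> norm v) \<and> \<phi> x = norm x"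

lemma smooth_at_scaleR:
  assumes "smooth_at x" "c > 0"
  shows "smooth_at (c *\<^sub>R x)"
  unfolding smooth_at_def
proof (intro allI impI)
  fix v :: 'a and e :: real
  assume "e > 0"
  then obtain t where t: "t > 0"
    "norm (x + t *\<^sub>R v) + norm (x - t *\<^sub>R v) < 2 * norm x + e * t"
    using assms by (auto simp: smooth_at_def)
  have *: "norm (c *\<^sub>R x + (c * t) *\<^sub>R v) = c * norm (x + t *\<^sub>R v)"
    "norm (c *\<^sub>R x - (c * t) *\<^sub>R v) = c * norm (x - t *\<^sub>R v)"
    using assms(2) by (simp_all flip: scaleR_scaleR scaleR_add_right scaleR_diff_right)
  have "c * (norm (x + t *\<^sub>R v) + norm (x - t *\<^sub>R v)) < c * (2 * norm x + e * t)"
    using t assms(2) by simp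
  then show "\<exists>t>0. norm (c *\<^sub>R x + t *\<^sub>R v) + norm (c *\<^sub>R x - t *\<^sub>R v)
      < 2 * norm (c *\<^sub>R x) + e * t"
    using t(1) assms(2) * by (intro exI[of _ "c * t"]) (simp add: algebra_simps)
qed

lemma smooth_at_isometry:
  assumes "smooth_at x" "T \<in> linear_isometries"
  shows "smooth_at (T x)"
  unfolding smooth_at_def
proof (intro allI impI)
  fix v :: 'a and e :: real
  assume "e > 0"
  from assms have T: "linear T" "surj T" "\<And>x. norm (T x) = norm x"
    by (auto simp: linear_isometries_def)
  obtain w where w: "v = T w" using T(2) by blast
  obtain t where t: "t > 0"
    "norm (x + t *\<^sub>R w) + norm (x - t *\<^sub>R w) < 2 * norm x + e * t"
    using assms \<open>e > 0\<close> by (auto simp: smooth_at_def)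
  have "T x + t *\<^sub>R v = T (x + t *\<^sub>R w)" "T x - t *\<^sub>R v = T (x - t *\<^sub>R w)"
    by (simp_all add: w linear_add linear_diff linear_cmul T(1))
  then show "\<exists>t>0. norm (T x + t *\<^sub>R v) + norm (T x - t *\<^sub>R v) < 2 * norm (T x) + e * t"
    using t T(3) by (intro exI[of _ t]) auto
qed

text \<open>
  Replacing \<open>v\<close> by \<open>w\<close> changes the second difference by at most \<open>2 t norm (v - w)\<close>, which is again
  of the form \<open>e t\<close>.
\<close>

lemma smooth_at_dense_directions:
  assumes "closure D = UNIV"
    and D: "\<And>v e. v \<in> D \<Longrightarrow> e > 0 \<Longrightarrow>
      \<exists>t>0. norm (x + t *\<^sub>R v) + norm (x - t *\<^sub>R v) < 2 * norm x + e * t"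
  shows "smooth_at x"
  unfolding smooth_at_def
proof (intro allI impI)
  fix v :: 'a and e :: real
  assume "e > 0"
  obtain w where w: "w \<in> D" "dist w v < e / 4"
    using \<open>closure D = UNIV\<close> \<open>e > 0\<close> closure_approachable[of v D]
    by (metis UNIV_I zero_less_divide_iff zero_less_numeral)
  obtain t where t: "t > 0"
    "norm (x + t *\<^sub>R w) + norm (x - t *\<^sub>R w) < 2 * norm x + (e/2) * t"
    using D[OF w(1), of "e/2"] \<open>e > 0\<close> by auto
  have d: "norm (t *\<^sub>R (v - w)) \<le> t * (e/4)"
    using w(2) t(1) by (simp add: dist_norm norm_minus_commute)
  have "norm (x + t *\<^sub>R v) \<le> norm (x + t *\<^sub>R w) + norm (t *\<^sub>R (v - w))"
    by (rule order_trans[OF _ norm_triangle_ineq]) (simp add: algebra_simps)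
  moreover have "norm (x - t *\<^sub>R v) \<le> norm (x - t *\<^sub>R w) + norm (t *\<^sub>R (v - w))"
    by (rule order_trans[OF _ norm_triangle_ineq4]) (simp add: algebra_simps)
  ultimately show "\<exists>t>0. norm (x + t *\<^sub>R v) + norm (x - t *\<^sub>R v) < 2 * norm x + e * t"
    using t d by (intro exI[of _ t]) (auto simp: algebra_simps)
qed

text \<open>
  The infimum of the right-hand difference quotients is a subgradient: by convexity it lies above
  every left-hand quotient.
\<close>

lemma norm_slope_exists: "\<exists>l. norm_slope x v l"
proof -
  define R where "R = (\<lambda>t. (norm (x + t *\<^sub>R v) - norm x) / t) ` {0<..}"
  have three: "(norm x - norm (x - s *\<^sub>R v)) / s \<le> (norm (x + t *\<^sub>R v) - norm x) / t"
    if "s > 0" "t > 0" for s t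
  proof -
    have "(s + t) *\<^sub>R x = t *\<^sub>R (x - s *\<^sub>R v) + s *\<^sub>R (x + t *\<^sub>R v)"
      by (simp add: algebra_simps)
    then have "norm ((s + t) *\<^sub>R x) \<le> norm (t *\<^sub>R (x - s *\<^sub>R v)) + norm (s *\<^sub>R (x + t *\<^sub>R v))"
      by (metis norm_triangle_ineq)
    then have "(s + t) * norm x \<le> t * norm (x - s *\<^sub>R v) + s * norm (x + t *\<^sub>R v)"
      using that by simp
    then show ?thesis using that by (simp add: field_simps)
  qed
  have lower: "(norm x - norm (x - s *\<^sub>R v)) / s \<le> Inf R" if "s > 0" for s
    unfolding R_def using three[OF that] by (intro cINF_greatest) auto
  have upper: "Inf R \<le> (norm (x + t *\<^sub>R v) - norm x) / t" if "t > 0" for t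
    unfolding R_def using three[OF zero_less_one] that
    by (intro cINF_lower bdd_belowI2[where m="norm x - norm (x - v)"]) fastforce+
  have "norm_slope x v (Inf R)"
    unfolding norm_slope_def
  proof
    fix u :: real
    consider "u > 0" | "u = 0" | "u < 0" by linarith
    then show "norm x + u * Inf R \<le> norm (x + u *\<^sub>R v)"
      using upper[of u] lower[of "- u"] by cases (auto simp: field_simps)
  qed
  then show ?thesis by blast
qed

text \<open>
  Two different subgradients would make a corner: the second difference would be at least
  \<open>(l - m) t\<close>.
\<close>

lemma smooth_at_norm_slope_unique:
  assumes "smooth_at x" "norm_slope x v l" "norm_slope x v m"
  shows "l = m"
proof -
  have le: "l \<le> m" if "norm_slope x v l" "norm_slope x v m" for l m
  proof (rule ccontr)
    assume "\<not> l \<le> m"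
    then obtain t where "t > 0"
      "norm (x + t *\<^sub>R v) + norm (x - t *\<^sub>R v) < 2 * norm x + (l - m) * t"
      using assms(1)[unfolded smooth_at_def, rule_format, of "l - m" v] by auto
    moreover have "norm x + t * l \<le> norm (x + t *\<^sub>R v)" "norm x - t * m \<le> norm (x - t *\<^sub>R v)"
      using that(1)[unfolded norm_slope_def, THEN spec, of t]
        that(2)[unfolded norm_slope_def, THEN spec, of "- t"] by simp_all
    ultimately show False by (simp add: algebra_simps)
  qed
  show ?thesis using le assms(2,3) by (meson order_antisym)
qed

lemma norm_slope_scaleR:
  assumes "norm_slope x v l"
  shows "norm_slope x (c *\<^sub>R v) (c * l)"
  using assms unfolding norm_slope_def by (metis mult.assoc scaleR_scaleR)

text \<open>
  The error \<open>norm (x + u v) - norm x - u l\<close> is nonnegative for both signs of \<open>u\<close>, and the errors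
  for \<open>u\<close> and \<open>-u\<close> add up to the second difference; so each of them is \<open>o(u)\<close>.
\<close>

lemma smooth_at_slope_tendsto:
  assumes "smooth_at x" "norm_slope x v l"
  shows "((\<lambda>t. (norm (x + t *\<^sub>R v) - norm x) /\<^sub>R t) \<longlongrightarrow> l) (at 0)"
proof -
  have chord: "norm (x + t *\<^sub>R w) - norm x \<le> (t / s) * (norm (x + s *\<^sub>R w) - norm x)"
    if "0 < t" "t \<le> s" for t s w
  proof -
    have "x + t *\<^sub>R w = (1 - t/s) *\<^sub>R x + (t/s) *\<^sub>R (x + s *\<^sub>R w)"
      using that by (simp add: algebra_simps)
    then have "norm (x + t *\<^sub>R w) \<le> norm ((1 - t/s) *\<^sub>R x) + norm ((t/s) *\<^sub>R (x + s *\<^sub>R w))"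
      by (metis norm_triangle_ineq)
    also have "\<dots> = (1 - t/s) * norm x + (t/s) * norm (x + s *\<^sub>R w)"
      using that by simp
    finally show ?thesis by (simp add: algebra_simps)
  qed
  have slope: "norm x + u * l \<le> norm (x + u *\<^sub>R v)" for u
    using assms(2) by (simp add: norm_slope_def)
  show ?thesis
    unfolding tendsto_iff
  proof (intro allI impI)
    fix e :: real
    assume "e > 0"
    then obtain s where s: "s > 0"
      "norm (x + s *\<^sub>R v) + norm (x - s *\<^sub>R v) < 2 * norm x + e * s"
      using assms(1) by (auto simp: smooth_at_def)
    have near: "norm (x + u *\<^sub>R v) - norm x - u * l < e * \<bar>u\<bar>" if "u \<noteq> 0" "\<bar>u\<bar> < s" for u
    proof -
      have "norm (x + \<bar>u\<bar> *\<^sub>R v) - norm x + (norm (x + \<bar>u\<bar> *\<^sub>R (- v)) - norm x)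
          \<le> (\<bar>u\<bar> / s) * (norm (x + s *\<^sub>R v) - norm x) + (\<bar>u\<bar> / s) * (norm (x + s *\<^sub>R (- v)) - norm x)"
        using that by (intro add_mono chord) auto
      also have "\<dots> = (\<bar>u\<bar> / s) * (norm (x + s *\<^sub>R v) + norm (x - s *\<^sub>R v) - 2 * norm x)"
        by (simp add: algebra_simps)
      also have "\<dots> < (\<bar>u\<bar> / s) * (e * s)"
        using s that by (intro mult_strict_left_mono) auto
      also have "\<dots> = e * \<bar>u\<bar>" using s(1) by simp
      finally show ?thesis
        using slope[of "- u"] by (cases "u > 0") (auto simp: abs_if)
    qed
    have "dist ((norm (x + u *\<^sub>R v) - norm x) /\<^sub>R u) l < e" if "u \<noteq> 0" "\<bar>u\<bar> < s" for u
    proof -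
      have "(norm (x + u *\<^sub>R v) - norm x) /\<^sub>R u - l = (norm (x + u *\<^sub>R v) - norm x - u * l) / u"
        using that(1) by (simp add: field_simps)
      moreover have "\<bar>norm (x + u *\<^sub>R v) - norm x - u * l\<bar> < e * \<bar>u\<bar>"
        using near[OF that] slope[of u] by simp
      ultimately show ?thesis
        using that(1) by (simp add: dist_real_def abs_divide divide_less_eq)
    qed
    then show "\<forall>\<^sub>F u in at 0. dist ((norm (x + u *\<^sub>R v) - norm x) /\<^sub>R u) l < e"
      using s(1) by (auto simp: eventually_at intro!: exI[of _ s])
  qed
qed

text \<open>
  The unique slopes in all directions form the derivative. Homogeneity comes from uniqueness; the
  slope is subadditive by the triangle inequality, and being odd it is then additive.
\<close>

lemma smooth_at_norm_derivative:
  assumes "smooth_at x"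
  obtains D where "supports_at D x"
    "\<And>v. ((\<lambda>t. (norm (x + t *\<^sub>R v) - norm x) /\<^sub>R t) \<longlongrightarrow> D v) (at 0)"
proof -
  define D where "D v = (SOME l. norm_slope x v l)" for v
  have D: "norm_slope x v (D v)" for v
    unfolding D_def using norm_slope_exists by (rule someI_ex)
  have uniq: "norm_slope x v l \<Longrightarrow> D v = l" for v l
    using smooth_at_norm_slope_unique[OF assms D] by blast
  have lim: "((\<lambda>t. (norm (x + t *\<^sub>R v) - norm x) /\<^sub>R t) \<longlongrightarrow> D v) (at 0)" for v
    by (rule smooth_at_slope_tendsto[OF assms D])
  have scale: "D (c *\<^sub>R v) = c * D v" for c v
    by (rule uniq[OF norm_slope_scaleR[OF D]])
  have sub: "D (v + w) \<le> D v + D w" for v w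
  proof -
    let ?r = "\<lambda>v t. (norm (x + t *\<^sub>R v) - norm x) /\<^sub>R t"
    have "LIM t at_right 0. 2 * t :> at (0::real)"
      by (auto simp: filterlim_at eventually_at_right_less intro!: tendsto_eq_intros
        eventually_mono[OF eventually_at_right_less[of 0]])
    then have r: "((\<lambda>t. ?r v (2 * t)) \<longlongrightarrow> D v) (at_right 0)" for v
      using filterlim_compose[OF lim] by blast
    \<comment> \<open>\<open>x + t (v + w)\<close> is the midpoint of \<open>x + 2 t v\<close> and \<open>x + 2 t w\<close>, hence the factor 2.\<close>
    have half: "D (v + w) \<le> ?r v (2 * t) + ?r w (2 * t)" if "t > 0" for t
    proof -
      have "2 *\<^sub>R (x + t *\<^sub>R (v + w)) = (x + (2 * t) *\<^sub>R v) + (x + (2 * t) *\<^sub>R w)"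
        by (simp add: algebra_simps scaleR_2)
      then have "norm (2 *\<^sub>R (x + t *\<^sub>R (v + w))) \<le> norm (x + (2 * t) *\<^sub>R v) + norm (x + (2 * t) *\<^sub>R w)"
        by (metis norm_triangle_ineq)
      then have "2 * norm (x + t *\<^sub>R (v + w)) \<le> norm (x + (2 * t) *\<^sub>R v) + norm (x + (2 * t) *\<^sub>R w)"
        by simp
      moreover have "norm x + t * D (v + w) \<le> norm (x + t *\<^sub>R (v + w))"
        using D[of "v + w"] by (simp add: norm_slope_def)
      moreover have "D (v + w) * (2 * t) = 2 * (t * D (v + w))" by simp
      ultimately have "D (v + w) * (2 * t)
          \<le> (norm (x + (2 * t) *\<^sub>R v) - norm x) + (norm (x + (2 * t) *\<^sub>R w) - norm x)"
        by linarith
      then have "D (v + w)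
          \<le> ((norm (x + (2 * t) *\<^sub>R v) - norm x) + (norm (x + (2 * t) *\<^sub>R w) - norm x)) / (2 * t)"
        using that by (subst pos_le_divide_eq) auto
      then show ?thesis by (simp only: divide_inverse real_scaleR_def mult.commute distrib_left)
    qed
    show ?thesis
      by (rule tendsto_lowerbound[OF tendsto_add[OF r r]])
        (rule eventually_mono[OF eventually_at_right_less[of 0] half], assumption, simp)
  qed
  have neg: "D (- v) = - D v" for v using scale[of "-1" v] by simp
  have "linear D"
  proof
    fix v w
    show "D (v + w) = D v + D w"
      using sub[of v w] sub[of "- v" "- w"] neg[of "v + w"] neg[of v] neg[of w] by simp
  qed (simp add: scale)
  moreover have "D v \<le> norm v" for v
  proof -
    have "norm x + D v \<le> norm (x + v)"
      using D[of v, unfolded norm_slope_def, THEN spec, of 1] by simp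
    then show ?thesis using norm_triangle_ineq[of x v] by simp
  qed
  moreover have "D x = norm x"
  proof (rule uniq)
    have "norm x + u * norm x \<le> norm (x + u *\<^sub>R x)" for u
    proof -
      have "(1 + u) * norm x \<le> \<bar>1 + u\<bar> * norm x" by (intro mult_right_mono) auto
      also have "\<dots> = norm ((1 + u) *\<^sub>R x)" by simp
      finally show ?thesis by (simp only: scaleR_add_left distrib_right scaleR_one mult_1)
    qed
    then show "norm_slope x x (norm x)" by (simp add: norm_slope_def)
  qed
  ultimately show thesis using that lim by (auto simp: supports_at_def)
qed

lemma supports_at_bounded_linear:
  assumes "supports_at \<phi> x"
  shows "bounded_linear \<phi>"
proof -
  have lin: "linear \<phi>" and le: "\<And>v. \<phi> v \<le> norm v"
    using assms by (auto simp: supports_at_def)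
  have "norm (\<phi> v) \<le> norm v * 1" for v
    using le[of v] le[of "- v"] linear_neg[OF lin, of v] by (simp add: abs_le_iff)
  then show ?thesis
    using lin by (intro bounded_linear_intro[of \<phi> 1]) (auto simp: linear_add linear_cmul)
qed

text \<open>
  A support functional gives a subgradient along every line through \<open>x\<close>.
\<close>

lemma smooth_at_support_unique:
  assumes "smooth_at x" "supports_at \<phi> x" "supports_at \<psi> x"
  shows "\<phi> = \<psi>"
proof
  fix v
  have "norm_slope x v (f v)" if "supports_at f x" for f
    unfolding norm_slope_def
  proof
    fix u :: real
    have "f (x + u *\<^sub>R v) \<le> norm (x + u *\<^sub>R v)" using that by (simp add: supports_at_def)
    then show "norm x + u * f v \<le> norm (x + u *\<^sub>R v)"
      using that by (simp add: supports_at_def linear_add linear_cmul)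
  qed
  then show "\<phi> v = \<psi> v"
    using assms smooth_at_norm_slope_unique by blast
qed

section \<open>Mazur's theorem\<close>

text \<open>
  Along a short segment from \<open>y\<close> in direction \<open>v\<close>, take \<open>N\<close> consecutive points at spacing \<open>\<eta>\<close>. The
  second differences of the norm at them telescope to at most \<open>2 \<eta> norm v\<close>, since the norm is
  1-Lipschitz. If \<open>N > 2 norm v / e\<close>, not all of them can be at least \<open>e \<eta>\<close>.
\<close>

lemma small_second_difference_dense:
  fixes v :: "'a::real_normed_vector"
  assumes "e > 0"
  shows "closure {x. \<exists>t>0. norm (x + t *\<^sub>R v) + norm (x - t *\<^sub>R v) < 2 * norm x + e * t} = UNIV"
    (is "closure ?G = UNIV")
proof -
  have "\<exists>x\<in>?G. dist x y < d" if "d > 0" for y d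
  proof (rule ccontr)
    assume contra: "\<not> (\<exists>x\<in>?G. dist x y < d)"
    obtain N :: nat where N: "2 * norm v / e < real N" using reals_Archimedean2 by blast
    define \<eta> where "\<eta> = d / ((real N + 1) * (norm v + 1))"
    have "\<eta> > 0" using \<open>d > 0\<close> by (simp add: \<eta>_def add_nonneg_pos)
    define p where "p i = y + (real i * \<eta>) *\<^sub>R v" for i
    define h where "h i = norm (p i)" for i
    have step: "h (i + 1) - h i + e * \<eta> \<le> h (i + 2) - h (i + 1)" if "i < N" for i
    proof -
      have "dist (p (i + 1)) y = (real i + 1) * norm v * \<eta>"
        using \<open>\<eta> > 0\<close> by (simp add: p_def dist_norm)
      also have "\<dots> < ((real N + 1) * (norm v + 1)) * \<eta>"
        using that \<open>\<eta> > 0\<close> by (intro mult_strict_right_mono mult_le_less_imp_less) auto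
      also have "\<dots> = d"
        unfolding \<eta>_def by (simp add: add_nonneg_eq_0_iff)
      finally have "p (i + 1) \<notin> ?G" using contra by blast
      then have "2 * h (i + 1) + e * \<eta> \<le> norm (p (i + 1) + \<eta> *\<^sub>R v) + norm (p (i + 1) - \<eta> *\<^sub>R v)"
        using \<open>\<eta> > 0\<close> unfolding h_def mem_Collect_eq by (meson not_less)
      moreover have "p (i + 1) + \<eta> *\<^sub>R v = p (i + 2)" "p (i + 1) - \<eta> *\<^sub>R v = p i"
        by (simp_all add: p_def algebra_simps flip: scaleR_add_left)
      ultimately show ?thesis by (simp add: h_def)
    qed
    have "h 1 - h 0 + real i * (e * \<eta>) \<le> h (i + 1) - h i" if "i \<le> N" for i
      using that
    proof (induction i)
      case (Suc i)
      then show ?case using step[of i] by (simp add: algebra_simps)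
    qed simp
    from this[of N] have "h 1 - h 0 + real N * (e * \<eta>) \<le> h (N + 1) - h N" by simp
    moreover have "\<bar>h (i + 1) - h i\<bar> \<le> \<eta> * norm v" for i
    proof -
      have "p (i + 1) - p i = \<eta> *\<^sub>R v" by (simp add: p_def algebra_simps)
      then show ?thesis
        unfolding h_def using norm_triangle_ineq3[of "p (i + 1)" "p i"] \<open>\<eta> > 0\<close> by simp
    qed
    from this[of 0] this[of N] have "h (N + 1) - h N \<le> \<eta> * norm v" "h 0 - h 1 \<le> \<eta> * norm v"
      by auto
    ultimately have "(real N * e) * \<eta> \<le> (2 * norm v) * \<eta>" by (simp add: algebra_simps)
    then show False using N \<open>\<eta> > 0\<close> \<open>e > 0\<close> by (simp add: field_simps)
  qed
  then show ?thesis by (auto simp: closure_approachable)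
qed

lemma open_small_second_difference:
  "open {x. \<exists>t>0. norm (x + t *\<^sub>R v) + norm (x - t *\<^sub>R v) < 2 * norm x + e * t}"
proof -
  have "open (\<Union>t\<in>{0<..}. {x. norm (x + t *\<^sub>R v) + norm (x - t *\<^sub>R v) < 2 * norm x + e * t})"
    by (intro open_UN ballI open_Collect_less continuous_intros)
  also have "(\<Union>t\<in>{0<..}. {x. norm (x + t *\<^sub>R v) + norm (x - t *\<^sub>R v) < 2 * norm x + e * t})
      = {x. \<exists>t>0. norm (x + t *\<^sub>R v) + norm (x - t *\<^sub>R v) < 2 * norm x + e * t}"
    by auto
  finally show ?thesis .
qed

theorem Mazur_smooth_points_dense:
  assumes "separable_space (euclidean :: 'a::banach topology)"
  shows "closure {x::'a. smooth_at x} = UNIV"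
proof -
  obtain D :: "'a set" where D: "countable D" "closure D = UNIV"
    using assms by (auto simp: separable_space_def)
  define G where "G v n = {x. \<exists>t>0. norm (x + t *\<^sub>R v) + norm (x - t *\<^sub>R v)
    < 2 * norm x + inverse (Suc n) * t}" for v :: 'a and n
  define \<G> where "\<G> = (\<lambda>(v, n). G v n) ` (D \<times> UNIV)"
  have "Met_TC.mtopology closure_of \<Inter>\<G> = (UNIV :: 'a set)"
  proof (rule Met_TC.metric_Baire_category)
    show "Met_TC.mcomplete TYPE('a)" using mcomplete_iff_complete complete_UNIV by blast
    show "countable \<G>" using D(1) by (simp add: \<G>_def)
    fix T
    assume "T \<in> \<G>"
    then obtain v n where T: "T = G v n" by (auto simp: \<G>_def)
    have "open T" unfolding T G_def by (rule open_small_second_difference)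
    moreover have "closure T = UNIV"
      unfolding T G_def by (rule small_second_difference_dense) simp
    ultimately show "openin Met_TC.mtopology T \<and> Met_TC.mtopology closure_of T = UNIV"
      by simp
  qed
  moreover have "smooth_at x" if "x \<in> \<Inter>\<G>" for x
  proof (rule smooth_at_dense_directions[OF D(2)])
    fix v :: 'a and e :: real
    assume "v \<in> D" "e > 0"
    then obtain n where n: "inverse (Suc n) < e" using reals_Archimedean by blast
    have "x \<in> G v n" using that \<open>v \<in> D\<close> by (auto simp: \<G>_def)
    then obtain t where "t > 0" "norm (x + t *\<^sub>R v) + norm (x - t *\<^sub>R v)
      < 2 * norm x + inverse (Suc n) * t" by (auto simp: G_def)
    moreover from this have "inverse (Suc n) * t < e * t"
      by (intro mult_strict_right_mono n)
    ultimately show "\<exists>t>0. norm (x + t *\<^sub>R v) + norm (x - t *\<^sub>R v) < 2 * norm x + e * t"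
      by (intro exI[of _ t] conjI) linarith+
  qed
  then have "closure (\<Inter>\<G>) \<subseteq> closure {x. smooth_at x}" by (intro closure_mono) auto
  ultimately show ?thesis by auto
qed

text \<open>
  Smoothness passes from one nonzero point to its normalization and from there, by isometries,
  to the whole sphere.
\<close>

lemma transitive_smooth:
  fixes x :: "'a::banach"
  assumes "separable_space (euclidean :: 'a topology)" "transitive_norm TYPE('a)" "norm x = 1"
  shows "smooth_at x"
proof -
  have "x \<in> closure {x. smooth_at x}" by (simp add: Mazur_smooth_points_dense[OF assms(1)])
  then obtain y where y: "smooth_at y" "dist y x < 1"
    by (metis closure_approachable mem_Collect_eq zero_less_one)
  then have "y \<noteq> 0" using assms(3) by auto
  then have "(1 / norm y) *\<^sub>R y \<in> sphere 0 1" "x \<in> sphere 0 1"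
    using assms(3) by simp_all
  then obtain T where "T \<in> linear_isometries" "T ((1 / norm y) *\<^sub>R y) = x"
    using assms(2) unfolding transitive_norm_def by blast
  then show ?thesis
    using smooth_at_isometry[OF smooth_at_scaleR[OF y(1)]] \<open>y \<noteq> 0\<close>
    by (metis zero_less_divide_1_iff zero_less_norm_iff)
qed

section \<open>Quasi-interior points of convex sets\<close>

text \<open>
  Points from which one can move a little, within \<open>C\<close>, straight away from each \<open>a\<close> in a dense
  subset of \<open>C\<close>. The relative interior of \<open>C\<close> has this property, but may be empty
  in infinite dimensions, where the quasi-interior takes its place.
\<close>

definition quasi_interior :: "'a::real_normed_vector set \<Rightarrow> 'a set" where
  "quasi_interior C = {z \<in> C. C \<subseteq> closure {a \<in> C. \<exists>s>0. z + s *\<^sub>R (z - a) \<in> C}}"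

text \<open>
  Giving the missing weight of a partial sum to \<open>a 0\<close> makes it a finite convex combination.
\<close>

lemma closed_convex_sums:
  fixes a :: "nat \<Rightarrow> 'a::real_normed_vector"
  assumes "closed C" "convex C" "\<And>i. a i \<in> C"
    and "\<And>i. c i \<ge> 0" "c sums 1" "(\<lambda>i. c i *\<^sub>R a i) sums z"
  shows "z \<in> C"
proof -
  let ?S = "\<lambda>n. \<Sum>i<n. c i"
  have lim: "(\<lambda>n. (\<Sum>i<n. c i *\<^sub>R a i) + (1 - ?S n) *\<^sub>R a 0) \<longlonglongrightarrow> z + (1 - 1) *\<^sub>R a 0"
    using assms(5,6) unfolding sums_def
    by (intro tendsto_add tendsto_scaleR tendsto_diff tendsto_const)
  have mem: "(\<Sum>i<n. c i *\<^sub>R a i) + (1 - ?S n) *\<^sub>R a 0 \<in> C" for n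
  proof -
    have le: "?S n \<le> 1"
      using sum_le_suminf[OF sums_summable[OF assms(5)], of "{..<n}"] assms(4)
        sums_unique[OF assms(5), symmetric] by simp
    let ?k = "\<lambda>i. if i < n then c i else 1 - ?S n" and ?b = "\<lambda>i. if i < n then a i else a 0"
    have "?S n + (1 - ?S n) = 1" by simp
    then have "(\<Sum>i\<in>{..<Suc n}. ?k i) = 1" by (simp only: sum.lessThan_Suc) simp
    moreover have "?k i \<ge> 0" "?b i \<in> C" for i using assms(3,4) le by simp_all
    ultimately have "(\<Sum>i\<in>{..<Suc n}. ?k i *\<^sub>R ?b i) \<in> C"
      by (intro convex_sum[OF finite_lessThan assms(2)])
    then show ?thesis by (simp only: sum.lessThan_Suc) simp
  qed
  show ?thesis using closed_sequentially[OF assms(1) mem lim] by simp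
qed

text \<open>
  A dense set of the whole space may miss \<open>C\<close>; so for each of its points \<open>d\<close> and each \<open>n\<close> one picks
  a point of \<open>C\<close> that is closer than \<open>1 / (n + 1)\<close> to \<open>d\<close>, if there is one.
\<close>

lemma separable_dense_subset:
  fixes C :: "'a::metric_space set"
  assumes "separable_space (euclidean :: 'a topology)"
  obtains A where "countable A" "A \<subseteq> C" "C \<subseteq> closure A"
proof -
  obtain D :: "'a set" where D: "countable D" "closure D = UNIV"
    using assms by (auto simp: separable_space_def)
  define P where "P d n a \<longleftrightarrow> a \<in> C \<and> dist d a < inverse (Suc n)" for d a and n :: nat
  define A where "A = (\<lambda>(d, n). SOME a. P d n a) ` {(d, n) \<in> D \<times> UNIV. \<exists>a. P d n a}"
  have "countable A" unfolding A_def
    by (intro countable_image countable_subset[OF _ countable_SIGMA[OF D(1), of "\<lambda>_. UNIV"]]) auto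
  moreover have "A \<subseteq> C" by (auto simp: A_def P_def intro: someI2)
  moreover have "C \<subseteq> closure A"
  proof (clarsimp simp: closure_approachable)
    fix x :: 'a and e :: real
    assume "x \<in> C" "e > 0"
    then obtain n where n: "inverse (Suc n) < e / 2" using reals_Archimedean[of "e/2"] by auto
    obtain d where d: "d \<in> D" "dist d x < inverse (Suc n)"
      using D(2) closure_approachable[of x D] by (metis UNIV_I inverse_positive_iff_positive of_nat_0_less_iff zero_less_Suc)
    then have "P d n x" using \<open>x \<in> C\<close> by (simp add: P_def)
    then have P: "P d n (SOME a. P d n a)" by (rule someI)
    have "(SOME a. P d n a) \<in> A" using d(1) \<open>P d n x\<close> by (auto simp: A_def intro!: image_eqI[of _ _ "(d, n)"])
    moreover have "dist (SOME a. P d n a) x < e"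
      using P d(2) n dist_triangle3[of "SOME a. P d n a" x d] by (auto simp: P_def)
    ultimately show "\<exists>y\<in>A. dist y x < e" by blast
  qed
  ultimately show thesis using that by blast
qed

text \<open>
  A convex combination of a dense sequence \<open>a\<close> with positive weights \<open>c\<close> is quasi-interior. Moving
  it away from \<open>a j\<close> by the factor \<open>c j\<close> keeps it a convex combination: the weight of
  \<open>a j\<close> becomes \<open>(1 + c j) * c j - c j = (c j)\<^sup>2\<close>, still nonnegative.
\<close>

lemma quasi_interior_nonempty:
  fixes C :: "'a::banach set"
  assumes "separable_space (euclidean :: 'a topology)"
    and C: "closed C" "convex C" "bounded C" "C \<noteq> {}"
  shows "quasi_interior C \<noteq> {}"
proof -
  obtain A where A: "countable A" "A \<subseteq> C" "C \<subseteq> closure A"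
    using separable_dense_subset[OF assms(1)] by blast
  then have "A \<noteq> {}" using C(4) by auto
  define a where "a = from_nat_into A"
  have ra: "range a = A" using A(1) \<open>A \<noteq> {}\<close> by (simp add: a_def range_from_nat_into)
  then have aC: "a i \<in> C" for i using A(2) by blast
  define c :: "nat \<Rightarrow> real" where "c i = (1/2) ^ Suc i" for i
  have c: "c sums 1" unfolding c_def by (rule power_half_series)
  have cpos: "c i > 0" for i by (simp add: c_def)
  obtain B where B: "\<And>x. x \<in> C \<Longrightarrow> norm x \<le> B" using C(3) by (auto simp: bounded_iff)
  have "summable (\<lambda>i. c i *\<^sub>R a i)"
  proof (rule summable_comparison_test')
    show "summable (\<lambda>i. c i * B)" using c by (intro summable_mult2) (rule sums_summable)
    show "norm (c i *\<^sub>R a i) \<le> c i * B" for i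
      using B[OF aC[of i]] cpos[of i] by simp
  qed
  then obtain z where z: "(\<lambda>i. c i *\<^sub>R a i) sums z" by (auto simp: summable_def)
  have "z \<in> C" using closed_convex_sums[OF C(1,2) aC _ c z] cpos by (simp add: less_imp_le)
  moreover have "z + c j *\<^sub>R (z - a j) \<in> C" for j
  proof (rule closed_convex_sums[OF C(1,2) aC])
    let ?k = "\<lambda>i. (1 + c j) * c i - (if i = j then c j else 0)"
    show "?k i \<ge> 0" for i using cpos[of i] cpos[of j] by (auto simp: algebra_simps)
    have "?k sums ((1 + c j) * 1 - c j)"
      by (intro sums_diff sums_mult c sums_single)
    then show "?k sums 1" by simp
    have "(\<lambda>i. (1 + c j) *\<^sub>R (c i *\<^sub>R a i) - (if i = j then c i *\<^sub>R a i else 0))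
        sums ((1 + c j) *\<^sub>R z - c j *\<^sub>R a j)"
      by (intro sums_diff sums_scaleR_right z sums_single)
    moreover have "(1 + c j) *\<^sub>R (c i *\<^sub>R a i) - (if i = j then c i *\<^sub>R a i else 0) = ?k i *\<^sub>R a i" for i
      by (simp add: algebra_simps)
    ultimately show "(\<lambda>i. ?k i *\<^sub>R a i) sums (z + c j *\<^sub>R (z - a j))"
      by (simp add: algebra_simps)
  qed
  then have "A \<subseteq> {b \<in> C. \<exists>s>0. z + s *\<^sub>R (z - b) \<in> C}"
    using cpos aC by (fastforce simp flip: ra)
  then have "C \<subseteq> closure {b \<in> C. \<exists>s>0. z + s *\<^sub>R (z - b) \<in> C}"
    using A(3) closure_mono by blast
  ultimately show ?thesis by (auto simp: quasi_interior_def)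
qed

text \<open>
  Ekeland's variational principle. The set \<open>S p\<close> collects the points that improve on \<open>p\<close> at rate
  \<open>k\<close> or more. Moving repeatedly to an almost best point of \<open>S p\<close> makes these closed sets
  shrink to a single point, on which no improvement at rate \<open>k\<close> is possible.
\<close>

lemma Ekeland_maximal_point:
  fixes C :: "'a::complete_space set" and f :: "'a \<Rightarrow> real"
  assumes "closed C" "C \<noteq> {}" "continuous_on C f" "bdd_above (f ` C)" "k > 0"
  obtains p where "p \<in> C" "\<And>u. u \<in> C \<Longrightarrow> f u - f p \<le> k * dist u p"
proof -
  define S where "S p = {u \<in> C. k * dist u p \<le> f u - f p}" for p
  have self: "p \<in> S p" if "p \<in> C" for p using that by (simp add: S_def)
  have mono: "S q \<subseteq> S p" if "q \<in> S p" for p q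
  proof
    fix u assume "u \<in> S q"
    moreover have "k * dist u p \<le> k * dist u q + k * dist q p"
      using dist_triangle[of u p q] \<open>k > 0\<close> by (simp flip: distrib_left)
    ultimately show "u \<in> S p" using that by (auto simp: S_def)
  qed
  have next_pt: "\<exists>q. q \<in> S p \<and> (\<forall>u\<in>S p. f u \<le> f q + (1/2) ^ n)" if "p \<in> C" for p n
  proof -
    have bdd: "bdd_above (f ` S p)"
      using assms(4) by (rule bdd_above_mono) (auto simp: S_def)
    have "Sup (f ` S p) - (1/2) ^ n < Sup (f ` S p)" by simp
    then obtain q where "q \<in> S p" "Sup (f ` S p) - (1/2) ^ n < f q"
      using less_cSup_iff[OF _ bdd] self[OF \<open>p \<in> C\<close>] by blast
    moreover have "f u \<le> Sup (f ` S p)" if "u \<in> S p" for u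
      using that bdd by (intro cSup_upper) auto
    ultimately show ?thesis by (intro exI[of _ q]) force
  qed
  have "\<exists>x. \<forall>n. x n \<in> C \<and> (x (Suc n) \<in> S (x n) \<and> (\<forall>u\<in>S (x n). f u \<le> f (x (Suc n)) + (1/2) ^ n))"
    by (rule dependent_nat_choice) (use assms(2) next_pt in \<open>auto simp: S_def\<close>)
  then obtain x where x: "\<And>n. x n \<in> C" "\<And>n. x (Suc n) \<in> S (x n)"
    "\<And>n u. u \<in> S (x n) \<Longrightarrow> f u \<le> f (x (Suc n)) + (1/2) ^ n" by metis
  have small: "dist u (x (Suc n)) \<le> (1/2) ^ n / k" if "u \<in> S (x (Suc n))" for u n
  proof -
    have "k * dist u (x (Suc n)) \<le> (1/2) ^ n"
      using that x(3)[of u n] mono[OF x(2), of n] by (auto simp: S_def)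
    then show ?thesis using \<open>k > 0\<close> by (simp add: field_simps)
  qed
  have tiny: "\<exists>n. \<forall>u\<in>S (x (Suc n)). \<forall>w\<in>S (x (Suc n)). dist u w < e" if "e > 0" for e
  proof -
    have "e * k / 2 > 0" using that \<open>k > 0\<close> by simp
    then obtain n where n: "(1/2) ^ n < e * k / 2"
      using real_arch_pow_inv[of "e * k / 2" "1/2"] by auto
    then have "(1/2) ^ n / k < e / 2" using \<open>k > 0\<close> by (simp add: field_simps)
    then have "dist u w < e" if "u \<in> S (x (Suc n))" "w \<in> S (x (Suc n))" for u w
      using small[OF that(1)] small[OF that(2)] dist_triangle2[of u w "x (Suc n)"] by linarith
    then show ?thesis by blast
  qed
  obtain p where p: "\<And>n. p \<in> S (x (Suc n))"
  proof (rule decreasing_closed_nest[of "\<lambda>n. S (x (Suc n))"])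
    show "closed (S (x (Suc n)))" for n
    proof -
      have "continuous_on C (\<lambda>u. f u - f (x (Suc n)) - k * dist u (x (Suc n)))"
        by (intro continuous_intros assms)
      then have "closed (C \<inter> (\<lambda>u. f u - f (x (Suc n)) - k * dist u (x (Suc n))) -` {0..})"
        using assms(1) closed_atLeast by (rule continuous_closed_preimage)
      moreover have "C \<inter> (\<lambda>u. f u - f (x (Suc n)) - k * dist u (x (Suc n))) -` {0..} = S (x (Suc n))"
        by (auto simp: S_def)
      ultimately show ?thesis by simp
    qed
    show "S (x (Suc n)) \<noteq> {}" for n using self x(1) by blast
    show "S (x (Suc n)) \<subseteq> S (x (Suc m))" if "m \<le> n" for m n
      using that by (rule lift_Suc_antimono_le[rotated]) (rule mono[OF x(2)])
  qed (use tiny in auto)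
  have "f u - f p \<le> k * dist u p" if "u \<in> C" for u
  proof (rule ccontr)
    assume not: "\<not> ?thesis"
    then have "u \<in> S p" using that by (simp add: S_def)
    then have "u \<in> S (x (Suc n))" for n using mono[OF p] by blast
    then have "dist u p < e" if "e > 0" for e using tiny[OF that] p by blast
    then have "u = p" by (metis dist_pos_lt less_irrefl)
    then show False using not by simp
  qed
  then show thesis using that p[of 0] by (auto simp: S_def)
qed

text \<open>
  Where \<open>f\<close> rises at rate at most \<open>k\<close> in all directions that lead into \<open>C\<close>, it also falls at rate
  at most \<open>k\<close>: the direction opposite to \<open>a - p\<close> leads into \<open>C\<close> too, for densely many \<open>a\<close>.
\<close>

lemma quasi_interior_slope_bound:
  fixes f :: "'a::real_normed_vector \<Rightarrow> real"
  assumes "bounded_linear f" "p \<in> quasi_interior C" "y \<in> C"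
    and p: "\<And>u. u \<in> C \<Longrightarrow> f u - f p \<le> k * norm (u - p)"
  shows "f p - f y \<le> k * norm (y - p)"
proof -
  interpret f: bounded_linear f by fact
  let ?A = "{a \<in> C. \<exists>s>0. p + s *\<^sub>R (p - a) \<in> C}"
  have "?A \<subseteq> {u. f p - f u \<le> k * norm (u - p)}"
  proof clarify
    fix a and s :: real
    assume "s > 0" "p + s *\<^sub>R (p - a) \<in> C"
    from p[OF this(2)] have "s * (f p - f a) \<le> k * (s * norm (p - a))"
      using \<open>s > 0\<close> by (simp add: f.add f.scaleR f.diff)
    then have "s * (f p - f a) \<le> s * (k * norm (a - p))"
      by (simp only: norm_minus_commute mult.left_commute)
    then show "f p - f a \<le> k * norm (a - p)" using \<open>s > 0\<close> by simp
  qed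
  moreover have "closed {u. f p - f u \<le> k * norm (u - p)}"
    by (intro closed_Collect_le continuous_intros f.continuous_on)
  ultimately have "closure ?A \<subseteq> {u. f p - f u \<le> k * norm (u - p)}" by (rule closure_minimal)
  then show ?thesis using assms(2,3) by (auto simp: quasi_interior_def)
qed

text \<open>
  At an Ekeland point for small \<open>k\<close> that is quasi-interior, \<open>f\<close> would vary so slowly
  in both directions that its values over \<open>C\<close> could not differ by as much as \<open>f x - f y\<close>.
\<close>

lemma not_all_quasi_interior:
  fixes C :: "'a::banach set"
  assumes "closed C" "bounded C" "x \<in> C" "y \<in> C" "bounded_linear f" "f x \<noteq> (f y :: real)"
  shows "\<exists>p\<in>C. p \<notin> quasi_interior C"
proof -
  \<comment> \<open>Small enough that \<open>x\<close> and \<open>y\<close> together deviate by half of \<open>\<bar>f x - f y\<bar>\<close> at most;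
    adding 1 to the diameter avoids a case distinction.\<close>
  define k where "k = \<bar>f x - f y\<bar> / (4 * (diameter C + 1))"
  have diam: "diameter C \<ge> 0" by (rule diameter_ge_0[OF assms(2)])
  have "k > 0" using assms(6) diam by (simp add: k_def)
  have "bounded (f ` C)" using assms(2,5) by (rule bounded_linear_image)
  then obtain p where p: "p \<in> C" "\<And>u. u \<in> C \<Longrightarrow> f u - f p \<le> k * dist u p"
    using Ekeland_maximal_point[OF assms(1) _ linear_continuous_on[OF assms(5)] bounded_imp_bdd_above \<open>k > 0\<close>]
      assms(3) by blast
  have "p \<notin> quasi_interior C"
  proof
    assume q: "p \<in> quasi_interior C"
    have "\<bar>f u - f p\<bar> \<le> k * (diameter C + 1)" if "u \<in> C" for u
    proof -
      have "f p - f u \<le> k * dist u p"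
        unfolding dist_norm
      proof (rule quasi_interior_slope_bound)
        show "f w - f p \<le> k * norm (w - p)" if "w \<in> C" for w
          using p(2)[OF that] by (simp add: dist_norm)
      qed (use assms(5) q that in auto)
      moreover have "k * dist u p \<le> k * (diameter C + 1)"
        using diameter_bounded_bound[OF assms(2) that p(1)] \<open>k > 0\<close> by simp
      ultimately show ?thesis using p(2)[OF that] by linarith
    qed
    from this[OF assms(3)] this[OF assms(4)] have "\<bar>f x - f y\<bar> \<le> 2 * (k * (diameter C + 1))" by linarith
    also have "\<dots> = \<bar>f x - f y\<bar> / 2" using diam by (simp add: k_def field_simps)
    finally show False using assms(6) by simp
  qed
  then show ?thesis using p(1) by blast
qed

lemma quasi_interior_linear_isometry:
  assumes "linear T" "\<And>x. norm (T x) = norm x" "T ` C = C" "T p \<in> quasi_interior C" "p \<in> C"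
  shows "p \<in> quasi_interior C"
proof -
  have inC: "T u \<in> C \<longleftrightarrow> u \<in> C" for u
  proof -
    have "inj T" using assms(1,2) by (metis linear_injective_0 norm_eq_zero)
    then show ?thesis using assms(3) by (metis inj_image_mem_iff)
  qed
  have "u \<in> closure {a \<in> C. \<exists>s>0. p + s *\<^sub>R (p - a) \<in> C}" if "u \<in> C" for u
    unfolding closure_approachable
  proof (intro allI impI)
    fix e :: real
    assume "e > 0"
    have "T u \<in> closure {a \<in> C. \<exists>s>0. T p + s *\<^sub>R (T p - a) \<in> C}"
      using assms(4) inC that by (auto simp: quasi_interior_def)
    then obtain b s where b: "b \<in> C" "dist b (T u) < e" "s > 0" "T p + s *\<^sub>R (T p - b) \<in> C"
      using \<open>e > 0\<close> by (auto simp: closure_approachable)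
    obtain a where a: "a \<in> C" "b = T a" using b(1) assms(3) by blast
    have "dist a u < e"
      using b(2) assms(2)[of "a - u"] by (simp add: a(2) dist_norm linear_diff[OF assms(1)])
    moreover have "T (p + s *\<^sub>R (p - a)) \<in> C"
      using b(4) by (simp add: a(2) linear_add linear_diff linear_cmul assms(1))
    ultimately show "\<exists>y\<in>{a \<in> C. \<exists>s>0. p + s *\<^sub>R (p - a) \<in> C}. dist y u < e"
      using a(1) b(3) inC by blast
  qed
  then show ?thesis using assms(5) by (auto simp: quasi_interior_def)
qed

section \<open>Separable transitive spaces\<close>

text \<open>
  The isometry \<open>T\<close> that maps \<open>p\<close> to \<open>z\<close> acts on the whole face: \<open>\<phi> \<circ> T\<close> and \<open>\<phi>\<close> both support the
  ball at the smooth point \<open>p\<close>, so they agree.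
\<close>

lemma transitive_face_quasi_interior:
  fixes \<phi> :: "'a::banach \<Rightarrow> real"
  assumes sep: "separable_space (euclidean :: 'a topology)" and tr: "transitive_norm TYPE('a)"
    and \<phi>: "linear \<phi>" "\<And>v. \<phi> v \<le> norm v"
    and F: "F = {u. norm u \<le> 1 \<and> \<phi> u = 1}"
    and z: "z \<in> quasi_interior F" and p: "p \<in> F"
  shows "p \<in> quasi_interior F"
proof -
  have "norm u = 1" if "u \<in> F" for u using that \<phi>(2)[of u] by (auto simp: F)
  moreover have "z \<in> F" using z by (simp add: quasi_interior_def)
  ultimately have "norm p = 1" "norm z = 1" "\<phi> p = 1" "\<phi> z = 1" using p by (auto simp: F)
  then have "p \<in> sphere 0 1" "z \<in> sphere 0 1" by simp_all
  then obtain T where "T \<in> linear_isometries" and Tp: "T p = z"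
    using tr unfolding transitive_norm_def by blast
  then have T: "linear T" "surj T" "\<And>x. norm (T x) = norm x" by (auto simp: linear_isometries_def)
  have "supports_at (\<phi> \<circ> T) p"
    using \<phi> T(1,3) linear_compose[OF T(1) \<phi>(1)] \<open>norm p = 1\<close> \<open>\<phi> z = 1\<close>
    by (auto simp: supports_at_def Tp) (metis T(3))
  moreover have "supports_at \<phi> p"
    using \<phi> \<open>norm p = 1\<close> \<open>\<phi> p = 1\<close> by (simp add: supports_at_def)
  ultimately have "\<phi> \<circ> T = \<phi>"
    using smooth_at_support_unique transitive_smooth[OF sep tr \<open>norm p = 1\<close>] by blast
  then have \<phi>T: "\<phi> (T u) = \<phi> u" for u by (metis comp_apply)
  have "T ` F = F"
  proof
    show "T ` F \<subseteq> F" using T(3) \<phi>T by (auto simp: F)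
    show "F \<subseteq> T ` F"
    proof
      fix u assume "u \<in> F"
      moreover obtain w where "u = T w" using T(2) by blast
      ultimately show "u \<in> T ` F" using T(3) \<phi>T by (auto simp: F)
    qed
  qed
  then show ?thesis using quasi_interior_linear_isometry[OF T(1,3)] z Tp p by blast
qed

text \<open>
  A segment in the sphere lies in a face supported at its midpoint, and the derivative of the
  norm in the direction \<open>x - y\<close> is a functional that is not constant on this face.
\<close>

lemma transitive_strictly_convex:
  assumes sep: "separable_space (euclidean :: 'a::banach topology)"
    and tr: "transitive_norm TYPE('a)"
  shows "strictly_convex_norm TYPE('a)"
  unfolding strictly_convex_norm_def
proof (intro ballI impI, rule ccontr)
  fix x y :: 'a
  assume xy: "x \<in> sphere 0 1" "y \<in> sphere 0 1" "x \<noteq> y"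
    and not: "\<not> norm ((1/2) *\<^sub>R (x + y)) < 1"
  define m where "m = (1/2) *\<^sub>R (x + y)"
  have "norm m = 1" using not xy norm_triangle_ineq[of x y] by (simp add: m_def)
  then obtain \<phi> where \<phi>: "supports_at \<phi> m"
    using smooth_at_norm_derivative transitive_smooth[OF sep tr] by blast
  then have lin: "linear \<phi>" and le: "\<And>v. \<phi> v \<le> norm v" and "\<phi> m = 1"
    using \<open>norm m = 1\<close> by (auto simp: supports_at_def)
  define F where "F = {u. norm u \<le> 1 \<and> \<phi> u = 1}"
  have "\<phi> x + \<phi> y = 2"
    using \<open>\<phi> m = 1\<close> by (simp add: m_def linear_cmul linear_add lin)
  then have xyF: "x \<in> F" "y \<in> F" using le[of x] le[of y] xy by (auto simp: F_def)
  have F_eq: "F = cball 0 1 \<inter> \<phi> -` {1}" by (auto simp: F_def)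
  have "closed F" unfolding F_eq
    by (intro closed_Int closed_cball closed_vimage closed_singleton
      linear_continuous_on[OF supports_at_bounded_linear[OF \<phi>]])
  moreover have "bounded F" unfolding F_eq by (rule bounded_subset[OF bounded_cball]) auto
  moreover have "convex F" unfolding F_eq
    by (intro convex_Int convex_cball convex_linear_vimage lin convex_singleton)
  ultimately obtain z where z: "z \<in> quasi_interior F"
    using quasi_interior_nonempty[OF sep] xyF by blast
  \<comment> \<open>The derivative of the norm at this unit vector takes the value \<open>norm (x - y)\<close> at \<open>x - y\<close>.\<close>
  have "norm ((1 / norm (x - y)) *\<^sub>R (x - y)) = 1" using xy(3) by simp
  then obtain f where f: "supports_at f ((1 / norm (x - y)) *\<^sub>R (x - y))"
    using smooth_at_norm_derivative transitive_smooth[OF sep tr] by blast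
  then have "f x \<noteq> f y"
    using xy(3) by (auto simp: supports_at_def linear_cmul linear_diff)
  then obtain p where "p \<in> F" "p \<notin> quasi_interior F"
    using not_all_quasi_interior[OF \<open>closed F\<close> \<open>bounded F\<close> xyF supports_at_bounded_linear[OF f]] by blast
  then show False
    using transitive_face_quasi_interior[OF sep tr lin le F_def z] by blast
qed

theorem theorem2:
  assumes "separable_space (euclidean :: 'a::banach topology)"
    and "transitive_norm TYPE('a)"
  shows "strictly_convex_norm TYPE('a) \<and> gateaux_differentiable_norm TYPE('a)"
proof
  show "strictly_convex_norm TYPE('a)" by (rule transitive_strictly_convex[OF assms])
  show "gateaux_differentiable_norm TYPE('a)"
    unfolding gateaux_differentiable_norm_def gateaux_differentiable_at_def
  proof
    fix x :: 'a
    assume "x \<in> sphere 0 1"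
    then have "smooth_at x" by (intro transitive_smooth[OF assms]) simp
    then show "\<exists>D. bounded_linear D \<and>
        (\<forall>v. ((\<lambda>t::real. (norm (x + t *\<^sub>R v) - norm x) /\<^sub>R t) \<longlongrightarrow> D v) (at 0))"
      using smooth_at_norm_derivative supports_at_bounded_linear by metis
  qed
qed

end
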